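(* Let $\mathcal{H}=(V,\mathcal{E})$ be a Steiner system. The following are equivalent: (i) the Boolean function $f_{\mathcal{H}}$ is irreducible; (ii) $\mathcal{H}_{e}\cong \mathcal{H}_{e'}$ for every $e,e'\in [V]^2$; (iii) $\mathcal{H}$ is $-2$-monomorphic.
   Context: A hypergraph is a pair $\mathcal{H}=(V,\mathcal{E})$ with $V$ a finite nonempty set (vertices) and $\mathcal{E}$ a set of subsets of $V$ (hyperedges; the empty set is allowed as a hyperedge). $[V]^m$ denotes the set of $m$-element subsets of $V$. Two hypergraphs $(V,\mathcal{E})$, $(V',\mathcal{E}')$ are isomorphic ($\cong$) if there is a bijection $\varphi:V\to V'$ such that for all $E\subseteq V$, $E\in\mathcal{E}$ iff $\varphi(E)\in\mathcal{E}'$. Steiner system: $\mathcal{H}=(V,\mathcal{E})$ is a Steiner system if for some $k$ one has $\mathcal{E}\subseteq [V]^k$ and every $e\in[V]^2$ is contained in exactly one $E\in\mathcal{E}$ (i.e. it is a $2$-$(n,k,1)$ design, $n=|V|$). The hypergraph $\mathcal{H}_e$: for $e=\{i,j\}\in[V]^2$ and a new vertex $l_e\notin V$, $\mathcal{H}_e=(V_e,\mathcal{E}_e)$ where $V_e=(V\setminus e)\cup\{l_e\}$ and a set $E\subseteq V_e$ belongs to $\mathcal{E}_e$ iff either $l_e\notin E$ and $E\in\mathcal{E}$, or $l_e\in E$ and exactly one or all three of the sets $(E\setminus\{l_e\})\cup\{i\}$, $(E\setminus\{l_e\})\cup\{j\}$, $(E\setminus\{l_e\})\cup\{i,j\}$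 belong to $\mathcal{E}$. $-2$-monomorphic: for $e\in[V]^2$ let $\mathcal{H}_{\setminus e}=(V\setminus e,\{E\in\mathcal{E}:E\cap e=\emptyset\})$ be the induced hypergraph obtained by deleting the two vertices of $e$. $\mathcal{H}$ is $-2$-monomorphic if $\mathcal{H}_{\setminus e}\cong\mathcal{H}_{\setminus e'}$ for all $e,e'\in[V]^2$. Boolean functions: a Boolean function is a map $f:\{0,1\}^n\to\{0,1\}$, $n\ge1$; $\Omega$ is the set of all of them. For $g$ of arity $m$ and $f$ of arity $n$, $g\le f$ ($g$ is a simple minor of $f$) if there is $\sigma:\{1,\dots,n\}\to\{1,\dots,m\}$ with $g(x_1,\dots,x_m)=f(x_{\sigma(1)},\dots,x_{\sigma(n)})$; $g<f$ means $g\le f$ and not $f\le g$. $f$ is irreducible if there is $f'\in\Omega$ with $f'<f$ such that every $g\in\Omega$ with $g<f$ satisfies $g\le f'$. For a hypergraph $\mathcal{H}=(V,\mathcal{E})$ (with $V$ identified with $\{1,\dots,n\}$), $f_{\mathcal{H}}$ is the $n$-ary Boolean function given by evaluating over $GF(2)$ the polynomial $P_{\mathcal{H}}=\sum_{E\in\mathcal{E}}\prod_{i\in E}x_i$ (irreducibility does not depend on the identification).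
   Formalization: The formal theorem assumes V has at least two vertices; with a single vertex (ii) and (iii) hold vacuously, while f_H is 0, 1 or x_1, which has no strict simple minor, so (i) fails. *)

theory Defs
  imports "HOL-Library.Ramsey" "HOL-Library.FuncSet" "HOL-Library.Z2"
begin

section \<open>Hypergraphs\<close>

type_synonym 'a hypergraph = "'a set \<times> 'a set set"

fun is_hypergraph :: "'a hypergraph \<Rightarrow> bool" where
  "is_hypergraph (V, \<E>) \<longleftrightarrow> finite V \<and> V \<noteq> {} \<and> \<E> \<subseteq> Pow V"

fun hg_iso :: "'a hypergraph \<Rightarrow> 'b hypergraph \<Rightarrow> bool" where
  "hg_iso (V, \<E>) (V', \<E>') \<longleftrightarrow>
     (\<exists>\<phi>. bij_betw \<phi> V V' \<and> (\<forall>E. E \<subseteq> V \<longrightarrow> (E \<in> \<E> \<longleftrightarrow> \<phi> ` E \<in> \<E>')))"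

text \<open>\<open>[V]\<^bsup>k\<^esup>\<close> is \<open>nsets V k\<close>, the set of \<open>k\<close>-element subsets of \<open>V\<close>.\<close>

fun steiner_system :: "'a hypergraph \<Rightarrow> bool" where
  "steiner_system (V, \<E>) \<longleftrightarrow> is_hypergraph (V, \<E>) \<and>
     (\<exists>k. \<E> \<subseteq> [V]\<^bsup>k\<^esup> \<and> (\<forall>e \<in> [V]\<^bsup>2\<^esup>. \<exists>!E. E \<in> \<E> \<and> e \<subseteq> E))"

text \<open>The hypergraph \<open>\<H>\<^sub>e\<close> obtained by identifying the two vertices of \<open>e = {i, j}\<close>.
  The type \<open>'a\<close> need not contain a vertex outside \<open>V\<close>, so \<open>\<H>\<^sub>e\<close> lives on \<open>'a option\<close>:
  old vertices are embedded by \<open>Some\<close> and \<open>None\<close> is the new vertex \<open>l\<^sub>e\<close>.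
  For \<open>D = Some -` E\<close>, which is \<open>E - {l\<^sub>e}\<close> as a subset of \<open>V - e\<close>, the three pairwise
  distinct sets \<open>D \<union> {i}\<close>, \<open>D \<union> {j}\<close>, \<open>D \<union> {i, j}\<close> form the set whose intersection with
  \<open>\<E>\<close> is counted.\<close>

fun identify :: "'a hypergraph \<Rightarrow> 'a set \<Rightarrow> 'a option hypergraph" where
  "identify (V, \<E>) e =
     (let V\<^sub>e = insert None (Some ` (V - e)) in
      (V\<^sub>e,
       {E. E \<subseteq> V\<^sub>e \<and>
           (None \<notin> E \<and> Some -` E \<in> \<E> \<or>
            None \<in> E \<and>
              card (insert (Some -` E \<union> e) ((\<lambda>i. Some -` E \<union> {i}) ` e) \<inter> \<E>) \<in> {1, 3})}))"

fun delete_vertices :: "'a hypergraph \<Rightarrow> 'a set \<Rightarrow> 'a hypergraph" where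
  "delete_vertices (V, \<E>) e = (V - e, {E \<in> \<E>. E \<inter> e = {}})"

fun minus2_monomorphic :: "'a hypergraph \<Rightarrow> bool" where
  "minus2_monomorphic (V, \<E>) \<longleftrightarrow>
     (\<forall>e \<in> [V]\<^bsup>2\<^esup>. \<forall>e' \<in> [V]\<^bsup>2\<^esup>.
        hg_iso (delete_vertices (V, \<E>) e) (delete_vertices (V, \<E>) e'))"


section \<open>Boolean functions\<close>

text \<open>The type \<open>bit\<close> is the field \<open>GF(2)\<close>. An \<open>n\<close>-tuple is an extensional function on
  \<open>{1..n}\<close>, and a Boolean function is a pair of its arity \<open>n\<close> and an extensional function on
  \<open>n\<close>-tuples.\<close>

type_synonym boolfun = "nat \<times> ((nat \<Rightarrow> bit) \<Rightarrow> bit)"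

abbreviation tuples :: "nat \<Rightarrow> (nat \<Rightarrow> bit) set" where
  "tuples n \<equiv> {1..n} \<rightarrow>\<^sub>E UNIV"

definition boolfuns :: "boolfun set" where
  "boolfuns = {(n, f). 1 \<le> n \<and> f \<in> tuples n \<rightarrow>\<^sub>E UNIV}"

fun simple_minor :: "boolfun \<Rightarrow> boolfun \<Rightarrow> bool" where
  "simple_minor (m, g) (n, f) \<longleftrightarrow>
     (\<exists>\<sigma> \<in> {1..n} \<rightarrow> {1..m}. \<forall>x \<in> tuples m. g x = f (\<lambda>i\<in>{1..n}. x (\<sigma> i)))"

definition strict_minor :: "boolfun \<Rightarrow> boolfun \<Rightarrow> bool" where
  "strict_minor g f \<longleftrightarrow> simple_minor g f \<and> \<not> simple_minor f g"

definition irreducible_boolfun :: "boolfun \<Rightarrow> bool" where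
  "irreducible_boolfun f \<longleftrightarrow>
     (\<exists>f' \<in> boolfuns. strict_minor f' f \<and>
        (\<forall>g \<in> boolfuns. strict_minor g f \<longrightarrow> simple_minor g f'))"

text \<open>The Boolean function of a hypergraph, where \<open>\<iota>\<close> identifies the vertex set with
  \<open>{1..card V}\<close>.\<close>

fun hg_boolfun :: "('a \<Rightarrow> nat) \<Rightarrow> 'a hypergraph \<Rightarrow> boolfun" where
  "hg_boolfun \<iota> (V, \<E>) =
     (card V, \<lambda>x\<in>tuples (card V). \<Sum>E\<in>\<E>. \<Prod>v\<in>E. x (\<iota> v))"

end

theory Submission
  imports Defs
begin

text \<open>Over \<open>GF(2)\<close> every Boolean function is given by a unique hypergraph polynomial, so simple
  minors of \<open>f\<^sub>\<H>\<close> correspond to pushing the edge set of \<open>\<H>\<close> forward along maps of vertices. All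
  variables of \<open>f\<^sub>\<H>\<close> being essential, its strict minors are the minors of the functions of the
  hypergraphs \<open>\<H>\<^sub>e\<close>, and \<open>f\<^sub>\<H>\<close> is irreducible iff one \<open>\<H>\<^sub>e\<close> has all others as minors. If the edges of the Steiner
  system have \<open>k \<ge> 3\<close> elements, no two edges cancel in \<open>\<H>\<^sub>e\<close>, every vertex of \<open>\<H>\<^sub>e\<close> is essential, and a
  minor with the same number of essential variables is an isomorphic copy. Moreover \<open>\<H>\<^sub>e\<close> and the
  hypergraph with \<open>e\<close> deleted determine each other: the new vertex of \<open>\<H>\<^sub>e\<close> can be recognised, and the
  edges of \<open>\<H>\<^sub>e\<close> through it arise from the sets of \<open>k - 1\<close> vertices all of whose pairs became uncovered, together
  with the set of vertices on none of those. For \<open>k = 2\<close> the hypergraph is a complete graph and all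
  three conditions hold.\<close>

subsection \<open>Hypergraph polynomials and minors\<close>

definition hpoly :: "'v set set \<Rightarrow> ('v \<Rightarrow> bit) \<Rightarrow> bit" where
  "hpoly \<E> x = (\<Sum>E\<in>\<E>. \<Prod>v\<in>E. x v)"

text \<open>Substituting \<open>x\<^sub>v := y (\<pi> v)\<close> turns the monomial of \<open>A\<close> into that of \<open>\<pi> ` A\<close>, because \<open>GF(2)\<close> is
  idempotent, and equal monomials cancel in pairs.\<close>

definition push :: "('v \<Rightarrow> 'w) \<Rightarrow> 'v set set \<Rightarrow> 'w set set" where
  "push \<pi> \<E> = {B. odd (card {A \<in> \<E>. \<pi> ` A = B})}"

lemma of_nat_bit: "(of_nat n :: bit) = of_bool (odd n)"
  by (induction n) (auto)

lemma prod_indicator_bit: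
  assumes "finite B"
  shows "(\<Prod>v\<in>B. of_bool (v \<in> A)) = (of_bool (B \<subseteq> A) :: bit)"
  using assms by (induction B rule: finite_induct) auto

lemma prod_image_bit:
  fixes y :: "'w \<Rightarrow> bit"
  assumes "finite A"
  shows "(\<Prod>v\<in>A. y (\<pi> v)) = (\<Prod>u\<in>\<pi> ` A. y u)"
  using assms
proof (induction A rule: finite_induct)
  case (insert a A)
  \<comment> \<open>A repeated factor is absorbed: if it is 0 the product already vanishes, and
    otherwise it is 1.\<close>
  have "y (\<pi> a) * (\<Prod>u\<in>\<pi> ` A. y u) = (\<Prod>u\<in>\<pi> ` A. y u)" if "\<pi> a \<in> \<pi> ` A"
  proof (cases "y (\<pi> a) = 0")
    case True
    then have "(\<Prod>u\<in>\<pi> ` A. y u) = 0"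
      using that insert.hyps(1) by (intro prod_zero) auto
    then show ?thesis
      by simp
  qed simp
  then show ?case
    using insert by (cases "\<pi> a \<in> \<pi> ` A") (auto simp: insert_absorb)
qed simp

text \<open>At the indicator of \<open>A\<close> exactly the monomials of edges inside
  \<open>A\<close> take the value 1. The term of \<open>A\<close> is split off from the proper
  subsets to prepare an induction.\<close>

lemma hpoly_indicator:
  assumes "finite \<E>" "\<And>E. E \<in> \<E> \<Longrightarrow> finite E"
  shows "hpoly \<E> (\<lambda>v. of_bool (v \<in> A)) = of_bool (A \<in> \<E>) + of_nat (card {B \<in> \<E>. B \<subset> A})"
proof -
  have "hpoly \<E> (\<lambda>v. of_bool (v \<in> A)) = (\<Sum>B\<in>\<E>. of_bool (B \<subseteq> A))"
    unfolding hpoly_def using assms(2) by (intro sum.cong) (auto simp: prod_indicator_bit)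
  also have "\<dots> = of_nat (card {B \<in> \<E>. B \<subseteq> A})"
    using assms(1) by (simp add: of_bool_def flip: sum.inter_filter)
  also have "{B \<in> \<E>. B \<subseteq> A} = (if A \<in> \<E> then insert A {B \<in> \<E>. B \<subset> A} else {B \<in> \<E>. B \<subset> A})"
    by auto
  finally show ?thesis
    using assms(1) by auto
qed

text \<open>Uniqueness of the polynomial of a Boolean function, by induction over proper subsets: at
  the indicator of \<open>A\<close> the contributions of smaller edges agree, hence so do the
  coefficients of \<open>A\<close>.\<close>

lemma hpoly_eqD:
  assumes "finite \<E>" "\<And>E. E \<in> \<E> \<Longrightarrow> finite E"
    and "finite \<F>" "\<And>E. E \<in> \<F> \<Longrightarrow> finite E"
    and eq: "\<And>x. hpoly \<E> x = hpoly \<F> x"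
  shows "\<E> = \<F>"
proof -
  have "A \<in> \<E> \<longleftrightarrow> A \<in> \<F>" if "finite A" for A
    using that
  proof (induction A rule: finite_psubset_induct)
    case (psubset A)
    have "{B \<in> \<E>. B \<subset> A} = {B \<in> \<F>. B \<subset> A}"
      using psubset.IH by auto
    then have "(of_bool (A \<in> \<E>) :: bit) = of_bool (A \<in> \<F>)"
      using eq[of "\<lambda>v. of_bool (v \<in> A)"] assms(1-4)
      by (simp only: hpoly_indicator add_right_cancel)
    then show ?case
      by (auto split: if_splits)
  qed
  then show ?thesis
    using assms(2,4) by blast
qed

lemma push_subset: "push \<pi> \<E> \<subseteq> (`) \<pi> ` \<E>"
proof
  fix B assume "B \<in> push \<pi> \<E>"
  then have "{A \<in> \<E>. \<pi> ` A = B} \<noteq> {}"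
    by (auto simp: push_def simp del: Collect_empty_eq)
  then show "B \<in> (`) \<pi> ` \<E>"
    by auto
qed

lemma finite_push: "finite \<E> \<Longrightarrow> finite (push \<pi> \<E>)"
  by (rule finite_subset[OF push_subset]) simp

lemma finite_push_edge:
  assumes "\<And>A. A \<in> \<E> \<Longrightarrow> finite A" "B \<in> push \<pi> \<E>"
  shows "finite B"
  using push_subset[of \<pi> \<E>] assms by auto

lemma push_inj:
  assumes "inj_on ((`) \<pi>) \<E>"
  shows "push \<pi> \<E> = (`) \<pi> ` \<E>"
proof (rule equalityI[OF push_subset], clarify)
  fix A assume "A \<in> \<E>"
  then have "{A' \<in> \<E>. \<pi> ` A' = \<pi> ` A} = {A}"
    using assms by (auto dest: inj_onD)
  then show "\<pi> ` A \<in> push \<pi> \<E>"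
    by (simp add: push_def)
qed

lemma push_inj_on:
  assumes "inj_on \<pi> V" "\<E> \<subseteq> Pow V"
  shows "push \<pi> \<E> = (`) \<pi> ` \<E>"
  using assms by (intro push_inj inj_on_subset[OF inj_on_image_Pow])

text \<open>Grouping the edges by their image, each image \<open>B\<close> collects as many copies
  of its monomial as its fibre has elements, and over GF(2) only the parity survives.\<close>

lemma hpoly_push:
  assumes "finite \<E>" "\<And>E. E \<in> \<E> \<Longrightarrow> finite E"
  shows "hpoly (push \<pi> \<E>) y = hpoly \<E> (\<lambda>v. y (\<pi> v))"
proof -
  have "hpoly \<E> (\<lambda>v. y (\<pi> v)) = (\<Sum>A\<in>\<E>. \<Prod>u\<in>\<pi> ` A. y u)"
    unfolding hpoly_def using assms(2) by (intro sum.cong prod_image_bit) auto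
  also have "\<dots> = (\<Sum>B\<in>(`) \<pi> ` \<E>. \<Sum>A\<in>{A \<in> \<E>. \<pi> ` A = B}. \<Prod>u\<in>\<pi> ` A. y u)"
    by (rule sum.image_gen[OF assms(1)])
  also have "\<dots> = (\<Sum>B\<in>(`) \<pi> ` \<E>. if B \<in> push \<pi> \<E> then \<Prod>u\<in>B. y u else 0)"
    by (intro sum.cong) (auto simp: push_def of_nat_bit)
  also have "\<dots> = (\<Sum>B\<in>push \<pi> \<E>. \<Prod>u\<in>B. y u)"
    using push_subset[of \<pi> \<E>] assms(1)
    by (simp add: sum.If_cases Int_absorb1)
  finally show ?thesis
    by (simp add: hpoly_def)
qed

lemma hpoly_cong:
  assumes "\<E> \<subseteq> Pow V" "\<And>v. v \<in> V \<Longrightarrow> x v = y v"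
  shows "hpoly \<E> x = hpoly \<E> y"
  unfolding hpoly_def using assms by (intro sum.cong prod.cong) auto

section \<open>Minors of hypergraph functions as maps between vertex sets\<close>

lemma simple_minor_trans:
  assumes "simple_minor f g" "simple_minor g h"
  shows "simple_minor f h"
proof -
  obtain m f' n g' p h' where fgh: "f = (m, f')" "g = (n, g')" "h = (p, h')"
    by (metis surj_pair)
  obtain \<sigma> where \<sigma>: "\<sigma> \<in> {1..n} \<rightarrow> {1..m}"
      "\<And>x. x \<in> tuples m \<Longrightarrow> f' x = g' (\<lambda>i\<in>{1..n}. x (\<sigma> i))"
    using assms(1) fgh by auto
  obtain \<tau> where \<tau>: "\<tau> \<in> {1..p} \<rightarrow> {1..n}"
      "\<And>x. x \<in> tuples n \<Longrightarrow> g' x = h' (\<lambda>i\<in>{1..p}. x (\<tau> i))"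
    using assms(2) fgh by auto
  have "f' x = h' (\<lambda>i\<in>{1..p}. x ((\<sigma> \<circ> \<tau>) i))" if "x \<in> tuples m" for x
  proof -
    have "f' x = h' (\<lambda>i\<in>{1..p}. (\<lambda>i\<in>{1..n}. x (\<sigma> i)) (\<tau> i))"
      using \<sigma>(2)[OF that] \<tau>(2)[of "\<lambda>i\<in>{1..n}. x (\<sigma> i)"] by simp
    also have "(\<lambda>i\<in>{1..p}. (\<lambda>i\<in>{1..n}. x (\<sigma> i)) (\<tau> i)) = (\<lambda>i\<in>{1..p}. x ((\<sigma> \<circ> \<tau>) i))"
      using \<tau>(1) by (intro restrict_ext) (auto simp: Pi_iff)
    finally show ?thesis .
  qed
  moreover have "\<sigma> \<circ> \<tau> \<in> {1..p} \<rightarrow> {1..m}"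
    using \<sigma>(1) \<tau>(1) by (auto simp: Pi_iff)
  ultimately show ?thesis
    unfolding fgh simple_minor.simps by blast
qed

text \<open>Composing substitutions with \<open>\<iota>\<close> or its inverse removes the numbering
  of the vertices, so that later arguments can use maps defined on \<open>V\<close> itself.\<close>

lemma simple_minor_hg:
  assumes E: "\<E> \<subseteq> Pow V" and \<iota>: "bij_betw \<iota> V {1..card V}"
  shows "simple_minor (m, g) (hg_boolfun \<iota> (V, \<E>)) \<longleftrightarrow>
    (\<exists>\<sigma> \<in> V \<rightarrow> {1..m}. \<forall>x \<in> tuples m. g x = hpoly \<E> (\<lambda>v. x (\<sigma> v)))"
    (is "?L \<longleftrightarrow> ?R")
proof -
  have \<iota>V: "\<iota> v \<in> {1..card V}" if "v \<in> V" for v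
    using bij_betw_apply[OF \<iota> that] .
  have eval: "(\<lambda>x\<in>tuples (card V). \<Sum>E\<in>\<E>. \<Prod>v\<in>E. x (\<iota> v)) (\<lambda>i\<in>{1..card V}. x (\<sigma> i))
      = hpoly \<E> (\<lambda>v. x (\<sigma> (\<iota> v)))" for x \<sigma>
  proof -
    have "(\<lambda>x\<in>tuples (card V). \<Sum>E\<in>\<E>. \<Prod>v\<in>E. x (\<iota> v)) (\<lambda>i\<in>{1..card V}. x (\<sigma> i))
      = hpoly \<E> (\<lambda>v. (\<lambda>i\<in>{1..card V}. x (\<sigma> i)) (\<iota> v))"
      by (simp add: hpoly_def restrict_apply)
    also have "\<dots> = hpoly \<E> (\<lambda>v. x (\<sigma> (\<iota> v)))"
      using \<iota>V by (intro hpoly_cong[OF E]) simp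
    finally show ?thesis .
  qed
  show ?thesis
  proof
    assume ?L
    then obtain \<sigma> where \<sigma>: "\<sigma> \<in> {1..card V} \<rightarrow> {1..m}"
        "\<forall>x \<in> tuples m. g x = hpoly \<E> (\<lambda>v. x (\<sigma> (\<iota> v)))"
      unfolding hg_boolfun.simps simple_minor.simps eval by blast
    moreover have "(\<lambda>v. \<sigma> (\<iota> v)) \<in> V \<rightarrow> {1..m}"
      using \<sigma>(1) \<iota>V by blast
    ultimately show ?R
      by (intro bexI[of _ "\<lambda>v. \<sigma> (\<iota> v)"])
  next
    assume ?R
    then obtain \<sigma> where \<sigma>: "\<sigma> \<in> V \<rightarrow> {1..m}" "\<forall>x \<in> tuples m. g x = hpoly \<E> (\<lambda>v. x (\<sigma> v))"
      by blast
    define \<tau> where "\<tau> = (\<lambda>i. \<sigma> (inv_into V \<iota> i))"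
    have \<tau>: "\<tau> \<in> {1..card V} \<rightarrow> {1..m}"
      using \<sigma>(1) bij_betw_apply[OF bij_betw_inv_into[OF \<iota>]] by (auto simp: \<tau>_def Pi_iff)
    have "hpoly \<E> (\<lambda>v. x (\<sigma> v)) = hpoly \<E> (\<lambda>v. x (\<tau> (\<iota> v)))" for x
      using bij_betw_inv_into_left[OF \<iota>] by (intro hpoly_cong[OF E]) (simp add: \<tau>_def)
    then show ?L
      unfolding hg_boolfun.simps simple_minor.simps eval using \<tau> \<sigma>(2) by auto
  qed
qed

text \<open>A substitution acts on polynomials as \<open>push\<close> by \<open>hpoly_push\<close>,
  and polynomials with equal values have equal edge sets by \<open>hpoly_eqD\<close>.\<close>

lemma simple_minor_hg_hg:
  assumes E: "finite V" "\<E> \<subseteq> Pow V" and \<iota>: "bij_betw \<iota> V {1..card V}"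
    and F: "finite W" "\<F> \<subseteq> Pow W" and \<kappa>: "bij_betw \<kappa> W {1..card W}"
  shows "simple_minor (hg_boolfun \<kappa> (W, \<F>)) (hg_boolfun \<iota> (V, \<E>)) \<longleftrightarrow>
    (\<exists>\<sigma> \<in> V \<rightarrow> W. push \<sigma> \<E> = \<F>)"
    (is "?L \<longleftrightarrow> ?R")
proof -
  have finE: "finite \<E>" "\<And>A. A \<in> \<E> \<Longrightarrow> finite A"
    using E by (auto intro: finite_subset)
  have finF: "finite \<F>" "\<And>A. A \<in> \<F> \<Longrightarrow> finite A"
    using F by (auto intro: finite_subset)
  show ?thesis
  proof
    assume ?L
    then obtain \<sigma> where \<sigma>: "\<sigma> \<in> V \<rightarrow> {1..card W}"
      "\<And>x. x \<in> tuples (card W) \<Longrightarrow> hpoly \<F> (\<lambda>w. x (\<kappa> w)) = hpoly \<E> (\<lambda>v. x (\<sigma> v))"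
      unfolding hg_boolfun.simps[of \<kappa>] simple_minor_hg[OF E(2) \<iota>]
      by (auto simp: hpoly_def)
    define \<tau> where "\<tau> = (\<lambda>v. inv_into W \<kappa> (\<sigma> v))"
    have \<tau>: "\<tau> \<in> V \<rightarrow> W"
      using \<sigma>(1) bij_betw_apply[OF bij_betw_inv_into[OF \<kappa>]] by (auto simp: \<tau>_def Pi_iff)
    have "hpoly (push \<tau> \<E>) y = hpoly \<F> y" for y
    proof -
      \<comment> \<open>The assignment \<open>y\<close> is read through the numbering of
        \<open>W\<close>; the restriction makes it a legitimate tuple.\<close>
      define x where "x = (\<lambda>i\<in>{1..card W}. y (inv_into W \<kappa> i))"
      have "hpoly (push \<tau> \<E>) y = hpoly \<E> (\<lambda>v. y (\<tau> v))"
        by (rule hpoly_push[OF finE])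
      also have "\<dots> = hpoly \<E> (\<lambda>v. x (\<sigma> v))"
        using \<sigma>(1) by (intro hpoly_cong[OF E(2)]) (auto simp: x_def \<tau>_def Pi_iff)
      also have "\<dots> = hpoly \<F> (\<lambda>w. x (\<kappa> w))"
        by (rule \<sigma>(2)[symmetric]) (unfold x_def restrict_PiE_iff, simp)
      also have "\<dots> = hpoly \<F> y"
        using bij_betw_apply[OF \<kappa>] bij_betw_inv_into_left[OF \<kappa>]
        by (intro hpoly_cong[OF F(2)]) (simp add: x_def)
      finally show ?thesis .
    qed
    then have "push \<tau> \<E> = \<F>"
      by (intro hpoly_eqD finite_push finE(1) finF(1))
        (auto intro: finite_push_edge[OF finE(2)] finF(2))
    then show ?R
      using \<tau> by blast
  next
    assume ?R
    then obtain \<tau> where \<tau>: "\<tau> \<in> V \<rightarrow> W" "push \<tau> \<E> = \<F>"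
      by blast
    have "(\<lambda>v. \<kappa> (\<tau> v)) \<in> V \<rightarrow> {1..card W}"
      using \<tau>(1) bij_betw_apply[OF \<kappa>] by blast
    moreover have "hpoly \<F> (\<lambda>w. x (\<kappa> w)) = hpoly \<E> (\<lambda>v. x (\<kappa> (\<tau> v)))" for x
      unfolding \<tau>(2)[symmetric] by (rule hpoly_push[OF finE])
    ultimately show ?L
      unfolding hg_boolfun.simps[of \<kappa>] simple_minor_hg[OF E(2) \<iota>]
      by (intro bexI[of _ "\<lambda>v. \<kappa> (\<tau> v)"]) (auto simp: hpoly_def)
  qed
qed

section \<open>Isomorphism of hypergraphs as equality of image edge sets\<close>

lemma hg_iso_iff:
  assumes "\<E> \<subseteq> Pow V" "\<F> \<subseteq> Pow W"
  shows "hg_iso (V, \<E>) (W, \<F>) \<longleftrightarrow> (\<exists>\<phi>. bij_betw \<phi> V W \<and> (`) \<phi> ` \<E> = \<F>)"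
proof -
  have "(\<forall>E. E \<subseteq> V \<longrightarrow> (E \<in> \<E> \<longleftrightarrow> \<phi> ` E \<in> \<F>)) \<longleftrightarrow> (`) \<phi> ` \<E> = \<F>" if \<phi>: "bij_betw \<phi> V W" for \<phi>
  proof
    assume *: "\<forall>E. E \<subseteq> V \<longrightarrow> (E \<in> \<E> \<longleftrightarrow> \<phi> ` E \<in> \<F>)"
    show "(`) \<phi> ` \<E> = \<F>"
    proof (intro equalityI subsetI)
      fix B assume "B \<in> \<F>"
      moreover from this obtain A where "A \<subseteq> V" "B = \<phi> ` A"
        using assms(2) bij_betw_imp_surj_on[OF \<phi>] by (metis PowD in_mono subset_imageE)
      ultimately show "B \<in> (`) \<phi> ` \<E>"
        using * by blast
    qed (use * assms(1) in auto)
  next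
    assume *: "(`) \<phi> ` \<E> = \<F>"
    show "\<forall>E. E \<subseteq> V \<longrightarrow> (E \<in> \<E> \<longleftrightarrow> \<phi> ` E \<in> \<F>)"
    proof (intro allI impI)
      fix E assume "E \<subseteq> V"
      then have "E' = E" if "E' \<in> \<E>" "\<phi> ` E = \<phi> ` E'" for E'
        using that assms(1) inj_on_image_eq_iff[OF bij_betw_imp_inj_on[OF \<phi>], of E E'] by auto
      then show "E \<in> \<E> \<longleftrightarrow> \<phi> ` E \<in> \<F>"
        using * by auto
    qed
  qed
  then show ?thesis
    unfolding hg_iso.simps by (intro ex_cong1 conj_cong refl)
qed

lemma hg_iso_sym:
  assumes "hg_iso (V, \<E>) (W, \<F>)" "\<E> \<subseteq> Pow V" "\<F> \<subseteq> Pow W"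
  shows "hg_iso (W, \<F>) (V, \<E>)"
proof -
  obtain \<phi> where \<phi>: "bij_betw \<phi> V W" "(`) \<phi> ` \<E> = \<F>"
    using assms hg_iso_iff by metis
  have "(`) (inv_into V \<phi>) ` \<F> = (\<lambda>E. inv_into V \<phi> ` \<phi> ` E) ` \<E>"
    using \<phi>(2) by auto
  also have "\<dots> = (\<lambda>E. E) ` \<E>"
    using assms(2) inv_into_image_cancel[OF bij_betw_imp_inj_on[OF \<phi>(1)]]
    by (intro image_cong refl) blast
  finally have "(`) (inv_into V \<phi>) ` \<F> = \<E>"
    by simp
  then show ?thesis
    unfolding hg_iso_iff[OF assms(3,2)] using bij_betw_inv_into[OF \<phi>(1)] by blast
qed

lemma hg_iso_trans:
  assumes "hg_iso (V, \<E>) (W, \<F>)" "hg_iso (W, \<F>) (U, \<G>)"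
    and "\<E> \<subseteq> Pow V" "\<F> \<subseteq> Pow W" "\<G> \<subseteq> Pow U"
  shows "hg_iso (V, \<E>) (U, \<G>)"
proof -
  obtain \<phi> where \<phi>: "bij_betw \<phi> V W" "(`) \<phi> ` \<E> = \<F>"
    using assms hg_iso_iff by metis
  obtain \<psi> where \<psi>: "bij_betw \<psi> W U" "(`) \<psi> ` \<F> = \<G>"
    using assms hg_iso_iff by metis
  have "(`) (\<psi> \<circ> \<phi>) ` \<E> = \<G>"
    unfolding \<psi>(2)[symmetric] \<phi>(2)[symmetric] by (simp add: image_image image_comp)
  then show ?thesis
    unfolding hg_iso_iff[OF assms(3,5)] using bij_betw_trans[OF \<phi>(1) \<psi>(1)] by blast
qed

subsection \<open>Identification of two vertices\<close>

text \<open>The quotient map from \<open>V\<close> onto the vertices of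
  \<open>identify (V, \<E>) e\<close>, where \<open>None\<close> plays the new vertex.\<close>

definition collapse :: "'a set \<Rightarrow> 'a \<Rightarrow> 'a option" where
  "collapse e v = (if v \<in> e then None else Some v)"

lemma collapse_image: "collapse e ` A = Some ` (A - e) \<union> (if A \<inter> e = {} then {} else {None})"
  by (auto simp: collapse_def)

lemma collapse_image_eq_iff:
  "collapse e ` A = B \<longleftrightarrow> A - e = Some -` B \<and> (A \<inter> e \<noteq> {} \<longleftrightarrow> None \<in> B)"
proof -
  have "B = Some ` (Some -` B) \<union> (if None \<in> B then {None} else {})"
    by (auto simp: image_iff) (metis not_None_eq)
  then show ?thesis
    unfolding collapse_image by (auto split: if_splits)
qed

lemma nsets2_E:
  assumes "e \<in> [V]\<^bsup>2\<^esup>"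
  obtains i j where "e = {i, j}" "i \<noteq> j" "i \<in> V" "j \<in> V"
  using assms by (auto simp: nsets_def card_2_iff)

lemma collapse_vertices:
  assumes "e \<in> [V]\<^bsup>2\<^esup>"
  shows "collapse e ` V = insert None (Some ` (V - e))"
  using assms by (auto simp: collapse_def elim: nsets2_E)

lemma card_collapse:
  assumes "finite V" "e \<in> [V]\<^bsup>2\<^esup>"
  shows "card (collapse e ` V) = card V - 1"
proof -
  have "card (Some ` (V - e)) = card V - 2" "2 \<le> card V"
    using assms by (auto simp: nsets_def card_image card_Diff_subset intro: card_mono)
      (metis card_mono)
  then show ?thesis
    using assms by (auto simp: collapse_vertices card_insert_if)
qed

text \<open>The fibre of a set containing \<open>None\<close> under \<open>collapse e\<close>
  consists of the three sets counted in \<open>identify\<close>, and "one or three" is just "odd". A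
  set without \<open>None\<close> has a single preimage, so no cancellation occurs there.\<close>

lemma identify_eq:
  assumes "\<E> \<subseteq> Pow V" "e \<in> [V]\<^bsup>2\<^esup>"
  shows "identify (V, \<E>) e = (collapse e ` V, push (collapse e) \<E>)"
proof -
  obtain i j where e: "e = {i, j}" "i \<noteq> j" "i \<in> V" "j \<in> V"
    using assms(2) by (rule nsets2_E)
  have "B \<in> push (collapse e) \<E> \<longleftrightarrow> B \<subseteq> collapse e ` V \<and>
           (None \<notin> B \<and> Some -` B \<in> \<E> \<or>
            None \<in> B \<and>
              card (insert (Some -` B \<union> e) ((\<lambda>i. Some -` B \<union> {i}) ` e) \<inter> \<E>) \<in> {1, 3})" (is "_ \<longleftrightarrow> ?R") for B
  proof (cases "B \<subseteq> collapse e ` V")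
    case False
    then show ?thesis
      using push_subset[of "collapse e" \<E>] assms(1) by blast
  next
    case True
    define D where "D = Some -` B"
    have D: "D \<subseteq> V - e"
      using True collapse_vertices[OF assms(2)] by (auto simp: D_def)
    show ?thesis
    proof (cases "None \<in> B")
      case None: True
      define S where "S = insert (D \<union> e) ((\<lambda>i. D \<union> {i}) ` e)"
      have "collapse e ` A = B \<longleftrightarrow> A \<in> S" for A
      proof
        assume "collapse e ` A = B"
        then have "A - e = D" "A \<inter> e \<noteq> {}"
          using None by (auto simp: collapse_image_eq_iff D_def)
        moreover from this have "A \<inter> e = {i} \<or> A \<inter> e = {j} \<or> A \<inter> e = e"
          using e by auto
        ultimately show "A \<in> S"
          unfolding S_def using e by auto
      next
        assume "A \<in> S"
        then have "A = D \<union> e \<or> A = D \<union> {i} \<or> A = D \<union> {j}"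
          using e(1) by (auto simp: S_def)
        then have "A - e = D" "A \<inter> e \<noteq> {}"
          using D e(1) by auto
        then show "collapse e ` A = B"
          using None by (simp add: collapse_image_eq_iff D_def)
      qed
      then have eq: "{A \<in> \<E>. collapse e ` A = B} = S \<inter> \<E>"
        by blast
      have "card (S \<inter> \<E>) \<le> card S"
        using e by (intro card_mono) (auto simp: S_def)
      also have "card S \<le> 3"
        unfolding e(1) S_def by (auto simp: card_insert_if)
      finally have "card (S \<inter> \<E>) \<in> {0, 1, 2, 3}"
        by auto
      then have "odd (card (S \<inter> \<E>)) \<longleftrightarrow> card (S \<inter> \<E>) \<in> {1, 3}"
        by (auto simp del: card_eq_0_iff)
      then show ?thesis
        using True None eq by (simp add: push_def D_def S_def)
    next
      case None: False
      have "collapse e ` A = B \<longleftrightarrow> A = D" for A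
        using None D by (auto simp: collapse_image_eq_iff D_def)
      then have "{A \<in> \<E>. collapse e ` A = B} = (if D \<in> \<E> then {D} else {})"
        by auto
      then show ?thesis
        using True None by (simp add: push_def D_def)
    qed
  qed
  then show ?thesis
    unfolding identify.simps Let_def collapse_vertices[OF assms(2), symmetric] by blast
qed

section \<open>Irreducibility expressed through the identified hypergraphs\<close>

lemma push_Pow:
  assumes "\<E> \<subseteq> Pow V"
  shows "push \<pi> \<E> \<subseteq> Pow (\<pi> ` V)"
  using push_subset[of \<pi> \<E>] assms by blast

text \<open>A vertex on an edge of the pushed hypergraph lies in the image of some edge. A minor in
  which every variable is essential therefore comes from a surjection.\<close>

lemma push_covers:
  assumes "\<sigma> \<in> W \<rightarrow> V" "\<F> \<subseteq> Pow W" "\<Union>(push \<sigma> \<F>) = V"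
  shows "\<sigma> ` W = V"
  using assms push_Pow[OF assms(2), of \<sigma>] by blast

lemma hg_boolfun_in_boolfuns:
  assumes "1 \<le> card V"
  shows "hg_boolfun \<iota> (V, \<E>) \<in> boolfuns"
  using assms by (auto simp: boolfuns_def)

lemma simple_minor_if_hg_iso:
  assumes "finite V" "\<E> \<subseteq> Pow V" "bij_betw \<iota> V {1..card V}"
    and "finite W" "\<F> \<subseteq> Pow W" "bij_betw \<kappa> W {1..card W}"
    and "hg_iso (V, \<E>) (W, \<F>)"
  shows "simple_minor (hg_boolfun \<kappa> (W, \<F>)) (hg_boolfun \<iota> (V, \<E>))"
proof -
  obtain \<phi> where \<phi>: "bij_betw \<phi> V W" "(`) \<phi> ` \<E> = \<F>"
    using assms hg_iso_iff by metis
  have "push \<phi> \<E> = \<F>"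
    using push_inj_on[OF bij_betw_imp_inj_on[OF \<phi>(1)] assms(2)] \<phi>(2) by simp
  then show ?thesis
    unfolding simple_minor_hg_hg[OF assms(1-6)] using bij_betw_imp_funcset[OF \<phi>(1)] by blast
qed

text \<open>The map behind the minor is onto because the edges cover \<open>W\<close>, hence
  bijective by equal finite cardinality; along a bijection no edges cancel.\<close>

lemma hg_iso_if_simple_minor:
  assumes "finite V" "\<E> \<subseteq> Pow V" "bij_betw \<iota> V {1..card V}"
    and "finite W" "\<F> \<subseteq> Pow W" "bij_betw \<kappa> W {1..card W}"
    and "card V = card W" "\<Union>\<F> = W"
    and "simple_minor (hg_boolfun \<kappa> (W, \<F>)) (hg_boolfun \<iota> (V, \<E>))"
  shows "hg_iso (V, \<E>) (W, \<F>)"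
proof -
  obtain \<sigma> where \<sigma>: "\<sigma> \<in> V \<rightarrow> W" "push \<sigma> \<E> = \<F>"
    using assms(9) unfolding simple_minor_hg_hg[OF assms(1-6)] by blast
  have "\<sigma> ` V = W"
    using push_covers[OF \<sigma>(1) assms(2)] \<sigma>(2) assms(8) by simp
  then have bij: "bij_betw \<sigma> V W"
    using eq_card_imp_inj_on[OF assms(1), of \<sigma>] assms(7) by (simp add: bij_betw_def)
  have "(`) \<sigma> ` \<E> = \<F>"
    using push_inj_on[OF bij_betw_imp_inj_on[OF bij] assms(2)] \<sigma>(2) by simp
  then show ?thesis
    using hg_iso_iff[OF assms(2,5)] bij by blast
qed

text \<open>Each \<open>\<H>\<^sub>e\<close> yields a strict minor, and every strict minor is a
  minor of one of these. So a largest strict minor lies below some \<open>e\<^sub>0\<close>, whose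
  function then lies above those of all \<open>e\<close>; conversely such a function is itself a
  largest strict minor.\<close>

lemma irreducible_hg_boolfun_iff:
  assumes V: "finite V" "2 \<le> card V" and E: "\<E> \<subseteq> Pow V" "\<Union>\<E> = V"
    and \<iota>: "bij_betw \<iota> V {1..card V}"
    and \<kappa>: "\<And>e. e \<in> [V]\<^bsup>2\<^esup> \<Longrightarrow> bij_betw (\<kappa> e) (collapse e ` V) {1..card (collapse e ` V)}"
  shows "irreducible_boolfun (hg_boolfun \<iota> (V, \<E>)) \<longleftrightarrow>
    (\<exists>e\<^sub>0 \<in> [V]\<^bsup>2\<^esup>. \<forall>e \<in> [V]\<^bsup>2\<^esup>. simple_minor (hg_boolfun (\<kappa> e) (identify (V, \<E>) e))
       (hg_boolfun (\<kappa> e\<^sub>0) (identify (V, \<E>) e\<^sub>0)))"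
proof -
  let ?f = "hg_boolfun \<iota> (V, \<E>)"
  define fe where "fe = (\<lambda>e. hg_boolfun (\<kappa> e) (collapse e ` V, push (collapse e) \<E>))"
  have fin: "finite (collapse e ` V)" for e
    using V by simp
  have finE: "finite \<E>" "\<And>A. A \<in> \<E> \<Longrightarrow> finite A"
    using V E by (auto intro: finite_subset)
  have fe_bool: "fe e \<in> boolfuns" if "e \<in> [V]\<^bsup>2\<^esup>" for e
    unfolding fe_def using V card_collapse[OF V(1) that] by (intro hg_boolfun_in_boolfuns) simp
  have strict: "strict_minor (fe e) ?f" if e: "e \<in> [V]\<^bsup>2\<^esup>" for e
  proof -
    have "simple_minor (fe e) ?f"
      unfolding fe_def simple_minor_hg_hg[OF V(1) E(1) \<iota> fin push_Pow[OF E(1)] \<kappa>[OF e]]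
      by (intro bexI[of _ "collapse e"]) auto
    moreover have "\<not> simple_minor ?f (fe e)"
    proof
      assume "simple_minor ?f (fe e)"
      then obtain \<tau> where \<tau>: "\<tau> \<in> collapse e ` V \<rightarrow> V" "push \<tau> (push (collapse e) \<E>) = \<E>"
        unfolding fe_def simple_minor_hg_hg[OF fin push_Pow[OF E(1)] \<kappa>[OF e] V(1) E(1) \<iota>] by blast
      \<comment> \<open>All vertices lie on edges, so the map would have to be onto
        \<open>V\<close>, although its domain has one vertex fewer.\<close>
      then have "\<tau> ` (collapse e ` V) = V"
        using push_covers[OF \<tau>(1) push_Pow[OF E(1)]] E(2) by simp
      then have "card V \<le> card (collapse e ` V)"
        using card_image_le[OF fin, of \<tau> e] by simp
      then show False
        using card_collapse[OF V(1) e] V(2) by simp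
    qed
    ultimately show ?thesis
      by (simp add: strict_minor_def)
  qed
  have factor: "\<exists>e \<in> [V]\<^bsup>2\<^esup>. simple_minor g (fe e)" if g: "strict_minor g ?f" for g
  proof -
    obtain m g' where g': "g = (m, g')"
      by (cases g)
    obtain \<sigma> where \<sigma>: "\<sigma> \<in> V \<rightarrow> {1..m}" "\<And>x. x \<in> tuples m \<Longrightarrow> g' x = hpoly \<E> (\<lambda>v. x (\<sigma> v))"
      using g unfolding strict_minor_def g' simple_minor_hg[OF E(1) \<iota>] by blast
    \<comment> \<open>An injective substitution can be undone, which would make the original
      function a minor of \<open>g\<close>.\<close>
    have "\<not> inj_on \<sigma> V"
    proof
      assume inj: "inj_on \<sigma> V"
      \<comment> \<open>Off the image of \<open>\<sigma>\<close> any valid index will do;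
        \<open>1\<close> is one because \<open>V\<close> is nonempty.\<close>
      define \<rho> where "\<rho> = (\<lambda>i. if i \<in> \<sigma> ` V then \<iota> (inv_into V \<sigma> i) else 1)"
      have "\<rho> \<in> {1..m} \<rightarrow> {1..card V}"
      proof
        fix i
        show "\<rho> i \<in> {1..card V}"
          using V(2) bij_betw_apply[OF \<iota> inv_into_into, of i \<sigma>] by (simp add: \<rho>_def)
      qed
      moreover have "hpoly \<E> (\<lambda>v. x (\<iota> v)) = g' (\<lambda>i\<in>{1..m}. x (\<rho> i))" for x
      proof -
        have "g' (\<lambda>i\<in>{1..m}. x (\<rho> i)) = hpoly \<E> (\<lambda>v. (\<lambda>i\<in>{1..m}. x (\<rho> i)) (\<sigma> v))"
          by (rule \<sigma>(2)) (unfold restrict_PiE_iff, simp)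
        also have "\<dots> = hpoly \<E> (\<lambda>v. x (\<iota> v))"
          using \<sigma>(1) inj by (intro hpoly_cong[OF E(1)]) (auto simp: \<rho>_def Pi_iff)
        finally show ?thesis ..
      qed
      ultimately have "simple_minor ?f g"
        unfolding g' hg_boolfun.simps simple_minor.simps
        by (intro bexI[of _ \<rho>]) (auto simp: hpoly_def)
      then show False
        using g by (simp add: strict_minor_def)
    qed
    then obtain v w where vw: "v \<in> V" "w \<in> V" "v \<noteq> w" "\<sigma> v = \<sigma> w"
      by (auto simp: inj_on_def)
    define e where "e = {v, w}"
    have e: "e \<in> [V]\<^bsup>2\<^esup>"
      using vw by (auto simp: e_def nsets_def)
    \<comment> \<open>As \<open>\<sigma>\<close> agrees on \<open>v\<close> and \<open>w\<close>, it
      factors through \<open>collapse e\<close>, with the common value assigned to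
      \<open>None\<close>.\<close>
    define \<tau> where "\<tau> = case_option (\<sigma> v) \<sigma>"
    have \<tau>: "\<tau> (collapse e u) = \<sigma> u" for u
      using vw by (auto simp: \<tau>_def collapse_def e_def)
    have "\<tau> \<in> collapse e ` V \<rightarrow> {1..m}"
      using \<sigma>(1) by (auto simp: \<tau> Pi_iff)
    moreover have "g' x = hpoly (push (collapse e) \<E>) (\<lambda>u. x (\<tau> u))" if "x \<in> tuples m" for x
      using \<sigma>(2)[OF that] by (simp only: hpoly_push[OF finE] \<tau>)
    ultimately have "simple_minor g (fe e)"
      unfolding g' fe_def simple_minor_hg[OF push_Pow[OF E(1)] \<kappa>[OF e]] by blast
    then show ?thesis
      using e by blast
  qed
  have "irreducible_boolfun ?f \<longleftrightarrow> (\<exists>e\<^sub>0 \<in> [V]\<^bsup>2\<^esup>. \<forall>e \<in> [V]\<^bsup>2\<^esup>. simple_minor (fe e) (fe e\<^sub>0))"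
    unfolding irreducible_boolfun_def
    using strict factor fe_bool simple_minor_trans by meson
  moreover have "hg_boolfun (\<kappa> e) (identify (V, \<E>) e) = fe e" if "e \<in> [V]\<^bsup>2\<^esup>" for e
    by (simp only: fe_def identify_eq[OF E(1) that])
  ultimately show ?thesis
    by (simp only: cong: bex_cong ball_cong)
qed

lemma ex_bij_betw_atLeast_1:
  assumes "finite V"
  obtains \<iota> where "bij_betw \<iota> V {1..card V}"
  using ex_bij_betw_nat_finite_1[OF assms] bij_betw_inv_into by blast

subsection \<open>Complete graphs\<close>

text \<open>Both sides represent the same composed substitution, so uniqueness of polynomials
  replaces a parity count over fibres.\<close>

lemma push_push:
  assumes "finite \<E>" "\<And>A. A \<in> \<E> \<Longrightarrow> finite A"
  shows "push \<sigma> (push \<pi> \<E>) = push (\<lambda>v. \<sigma> (\<pi> v)) \<E>"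
proof (rule hpoly_eqD)
  have push: "finite (push \<pi> \<E>)" "\<And>A. A \<in> push \<pi> \<E> \<Longrightarrow> finite A"
    using finite_push[OF assms(1)] finite_push_edge[OF assms(2)] by blast+
  show "finite (push \<sigma> (push \<pi> \<E>))" "finite (push (\<lambda>v. \<sigma> (\<pi> v)) \<E>)"
    by (rule finite_push, fact)+
  show "finite A" if "A \<in> push \<sigma> (push \<pi> \<E>)" for A
    using push(2) that by (rule finite_push_edge)
  show "finite A" if "A \<in> push (\<lambda>v. \<sigma> (\<pi> v)) \<E>" for A
    using assms(2) that by (rule finite_push_edge)
  show "hpoly (push \<sigma> (push \<pi> \<E>)) x = hpoly (push (\<lambda>v. \<sigma> (\<pi> v)) \<E>) x" for x
    by (simp only: hpoly_push push assms)
qed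

lemma push_cong:
  assumes "\<E> \<subseteq> Pow V" "\<And>v. v \<in> V \<Longrightarrow> \<sigma> v = \<tau> v"
  shows "push \<sigma> \<E> = push \<tau> \<E>"
proof -
  have "\<sigma> ` A = \<tau> ` A" if "A \<in> \<E>" for A
    using assms that by (intro image_cong) auto
  then show ?thesis
    by (auto simp: push_def cong: conj_cong)
qed

lemma ex_bij_betw_mapping_subset:
  assumes "finite V" "e \<subseteq> V" "e' \<subseteq> V" "card e = card e'"
  obtains \<phi> where "bij_betw \<phi> V V" "\<phi> ` e = e'"
proof -
  have fin: "finite e" "finite e'"
    using assms finite_subset by auto
  obtain f where f: "bij_betw f e e'"
    using finite_same_card_bij[OF fin assms(4)] by blast
  have "card (V - e) = card (V - e')"
    using assms fin by (simp add: card_Diff_subset)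
  then obtain g where g: "bij_betw g (V - e) (V - e')"
    using finite_same_card_bij assms(1) by (metis finite_Diff)
  define \<phi> where "\<phi> v = (if v \<in> e then f v else g v)" for v
  have "bij_betw \<phi> e e'"
    using f by (simp add: \<phi>_def cong: bij_betw_cong)
  moreover have "bij_betw \<phi> (V - e) (V - e')"
    using g by (rule bij_betw_cong[THEN iffD1, rotated]) (simp add: \<phi>_def)
  ultimately have "bij_betw \<phi> (e \<union> (V - e)) (e' \<union> (V - e'))"
    by (rule bij_betw_combine) auto
  moreover have "e \<union> (V - e) = V" "e' \<union> (V - e') = V"
    using assms by auto
  ultimately show thesis
    using that \<open>bij_betw \<phi> e e'\<close> by (auto simp: bij_betw_def)
qed

text \<open>A permutation of \<open>V\<close> taking \<open>e\<close> to \<open>e'\<close> preserves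
  the complete graph and descends to the quotients. This case stands apart because the edges joining
  a third vertex to the two vertices of \<open>e\<close> cancel.\<close>

lemma hg_iso_identify_complete:
  assumes "finite V" "e \<in> [V]\<^bsup>2\<^esup>" "e' \<in> [V]\<^bsup>2\<^esup>"
  shows "hg_iso (identify (V, [V]\<^bsup>2\<^esup>) e) (identify (V, [V]\<^bsup>2\<^esup>) e')"
proof -
  let ?\<E> = "[V]\<^bsup>2\<^esup>"
  have E: "?\<E> \<subseteq> Pow V" "finite ?\<E>" "\<And>A. A \<in> ?\<E> \<Longrightarrow> finite A"
    using assms(1) by (auto simp: nsets_def)
  obtain \<phi> where \<phi>: "bij_betw \<phi> V V" "\<phi> ` e = e'"
    using ex_bij_betw_mapping_subset[of V e e'] assms by (auto simp: nsets_def)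
  define \<psi> where "\<psi> = map_option \<phi>"
  have \<psi>: "\<psi> (collapse e v) = collapse e' (\<phi> v)" if "v \<in> V" for v
  proof -
    have "\<phi> v \<in> e' \<longleftrightarrow> v \<in> e"
      using \<phi> that assms(2) inj_on_image_mem_iff[of \<phi> V v e] by (auto simp: bij_betw_def nsets_def)
    then show ?thesis
      by (simp add: \<psi>_def collapse_def)
  qed
  have "\<psi> ` collapse e ` V = collapse e' ` \<phi> ` V"
    unfolding image_image using \<psi> by (rule image_cong[OF refl])
  then have im: "\<psi> ` collapse e ` V = collapse e' ` V"
    using \<phi>(1) by (simp add: bij_betw_def)
  have "inj_on \<psi> (collapse e ` V)"
    using assms by (intro eq_card_imp_inj_on) (auto simp: im card_collapse)
  then have bij: "bij_betw \<psi> (collapse e ` V) (collapse e' ` V)"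
    using im by (simp add: bij_betw_def)
  have "(`) \<psi> ` push (collapse e) ?\<E> = push \<psi> (push (collapse e) ?\<E>)"
    by (rule push_inj_on[OF bij_betw_imp_inj_on[OF bij] push_Pow[OF E(1)], symmetric])
  also have "\<dots> = push (\<lambda>v. \<psi> (collapse e v)) ?\<E>"
    by (rule push_push[OF E(2,3)])
  also have "\<dots> = push (\<lambda>v. collapse e' (\<phi> v)) ?\<E>"
    by (rule push_cong[OF E(1) \<psi>])
  also have "\<dots> = push (collapse e') (push \<phi> ?\<E>)"
    by (rule push_push[OF E(2,3), symmetric])
  also have "push \<phi> ?\<E> = ?\<E>"
    using push_inj_on[OF bij_betw_imp_inj_on[OF \<phi>(1)] E(1)] bij_betw_nsets[OF \<phi>(1), of 2]
    by (simp add: bij_betw_def)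
  finally show ?thesis
    unfolding identify_eq[OF E(1) assms(2)] identify_eq[OF E(1) assms(3)]
      hg_iso_iff[OF push_Pow[OF E(1)] push_Pow[OF E(1)]]
    using bij by blast
qed

lemma hg_iso_delete_complete:
  assumes "finite V" "e \<in> [V]\<^bsup>2\<^esup>" "e' \<in> [V]\<^bsup>2\<^esup>"
  shows "hg_iso (delete_vertices (V, [V]\<^bsup>2\<^esup>) e) (delete_vertices (V, [V]\<^bsup>2\<^esup>) e')"
proof -
  have eq: "delete_vertices (V, [V]\<^bsup>2\<^esup>) d = (V - d, [V - d]\<^bsup>2\<^esup>)" for d
    by (auto simp: nsets_def)
  have "card (V - e) = card (V - e')"
    using assms by (simp add: nsets_def card_Diff_subset)
  then obtain g where "bij_betw g (V - e) (V - e')"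
    using finite_same_card_bij assms(1) by (metis finite_Diff)
  moreover from this have "(`) g ` [V - e]\<^bsup>2\<^esup> = [V - e']\<^bsup>2\<^esup>"
    using bij_betw_nsets[of g "V - e" "V - e'" 2] by (simp add: bij_betw_def)
  ultimately show ?thesis
    unfolding eq by (subst hg_iso_iff) (auto simp: nsets_def)
qed

subsection \<open>Steiner systems\<close>

text \<open>Applied to \<open>U = V - e\<close> and the edges missing \<open>e\<close>, \<open>lines\<close> returns the traces on \<open>U\<close> of the
  edges meeting \<open>e\<close> in exactly one vertex (\<open>lines_delete\<close>). The remaining edge, the one through
  \<open>e\<close>, consists of the vertices on none of these traces, so \<open>rebuild\<close> recovers \<open>\<H>\<^sub>e\<close>
  from \<open>\<H>\<close> with \<open>e\<close> deleted.\<close>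

definition lines :: "nat \<Rightarrow> 'a set \<Rightarrow> 'a set set \<Rightarrow> 'a set set" where
  "lines k U \<G> = {D. D \<subseteq> U \<and> card D = k - 1 \<and>
     (\<forall>A\<in>\<G>. \<forall>v\<in>D. \<forall>w\<in>D. v \<in> A \<longrightarrow> w \<in> A \<longrightarrow> v = w)}"

definition rebuild :: "nat \<Rightarrow> 'a set \<Rightarrow> 'a set set \<Rightarrow> 'a option set set" where
  "rebuild k U \<G> = (`) Some ` \<G> \<union>
     (\<lambda>D. insert None (Some ` D)) ` insert (U - \<Union>(lines k U \<G>)) (lines k U \<G>)"

text \<open>Only cardinalities and incidences enter \<open>lines\<close>, and an injection preserves
  both.\<close>

lemma lines_image:
  assumes "inj_on \<phi> U" "\<G> \<subseteq> Pow U"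
  shows "lines k (\<phi> ` U) ((`) \<phi> ` \<G>) = (`) \<phi> ` lines k U \<G>"
proof -
  have iff: "\<phi> ` D \<in> lines k (\<phi> ` U) ((`) \<phi> ` \<G>) \<longleftrightarrow> D \<in> lines k U \<G>" if "D \<subseteq> U" for D
  proof -
    have inj: "inj_on \<phi> D"
      using assms(1) that by (rule inj_on_subset)
    have mem: "\<phi> v \<in> \<phi> ` A \<longleftrightarrow> v \<in> A" if "A \<in> \<G>" "v \<in> D" for A v
      using that \<open>D \<subseteq> U\<close> assms(2) by (intro inj_on_image_mem_iff[OF assms(1)]) auto
    have eq: "\<phi> v = \<phi> w \<longleftrightarrow> v = w" if "v \<in> D" "w \<in> D" for v w
      using inj_on_eq_iff[OF inj that] .
    show ?thesis
      using that by (auto simp: lines_def card_image[OF inj] mem eq)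
  qed
  show ?thesis
  proof (intro equalityI subsetI)
    fix D' assume D': "D' \<in> lines k (\<phi> ` U) ((`) \<phi> ` \<G>)"
    then have "D' \<subseteq> \<phi> ` U"
      by (simp add: lines_def)
    then obtain D where "D \<subseteq> U" "D' = \<phi> ` D"
      by (meson subset_imageE)
    then show "D' \<in> (`) \<phi> ` lines k U \<G>"
      using iff D' by blast
  next
    fix D' assume "D' \<in> (`) \<phi> ` lines k U \<G>"
    then obtain D where "D \<in> lines k U \<G>" "D' = \<phi> ` D"
      by blast
    moreover from this have "D \<subseteq> U"
      by (simp add: lines_def)
    ultimately show "D' \<in> lines k (\<phi> ` U) ((`) \<phi> ` \<G>)"
      using iff by blast
  qed
qed

text \<open>Since \<open>map_option\<close> fixes \<open>None\<close>, a relabelling of the old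
  vertices extends to the rebuilt hypergraph.\<close>

lemma rebuild_image:
  assumes "inj_on \<phi> U" "\<G> \<subseteq> Pow U"
  shows "rebuild k (\<phi> ` U) ((`) \<phi> ` \<G>) = (`) (map_option \<phi>) ` rebuild k U \<G>"
proof -
  have "\<Union>(lines k U \<G>) \<subseteq> U"
    by (auto simp: lines_def)
  then have "\<phi> ` U - \<Union>((`) \<phi> ` lines k U \<G>) = \<phi> ` (U - \<Union>(lines k U \<G>))"
    using inj_on_image_set_diff[OF assms(1), of U "\<Union>(lines k U \<G>)"] by (simp add: image_Union)
  then show ?thesis
    by (simp add: rebuild_def lines_image[OF assms] image_Un image_image)
qed

locale steiner =
  fixes V :: "'a set" and \<E> :: "'a set set" and k :: nat
  assumes finite_V: "finite V"
    and edge_subset: "\<E> \<subseteq> Pow V"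
    and card_edge: "A \<in> \<E> \<Longrightarrow> card A = k"
    and ex_edge: "v \<in> V \<Longrightarrow> w \<in> V \<Longrightarrow> v \<noteq> w \<Longrightarrow> \<exists>A\<in>\<E>. v \<in> A \<and> w \<in> A"
    and edge_unique: "A \<in> \<E> \<Longrightarrow> B \<in> \<E> \<Longrightarrow> v \<noteq> w \<Longrightarrow> v \<in> A \<Longrightarrow> w \<in> A \<Longrightarrow> v \<in> B \<Longrightarrow> w \<in> B \<Longrightarrow> A = B"
begin

lemma finite_edge: "A \<in> \<E> \<Longrightarrow> finite A"
  using edge_subset by (intro finite_subset[OF _ finite_V]) auto

lemma ex_edge_superset:
  assumes "e \<in> [V]\<^bsup>2\<^esup>"
  obtains F where "F \<in> \<E>" "e \<subseteq> F"
proof -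
  obtain i j where "e = {i, j}" "i \<noteq> j" "i \<in> V" "j \<in> V"
    using assms by (rule nsets2_E)
  then show thesis
    using ex_edge[of i j] that by auto
qed

lemma edge_superset_unique:
  assumes "e \<in> [V]\<^bsup>2\<^esup>" "A \<in> \<E>" "B \<in> \<E>" "e \<subseteq> A" "e \<subseteq> B"
  shows "A = B"
proof -
  obtain i j where "e = {i, j}" "i \<noteq> j"
    using assms(1) by (rule nsets2_E)
  then show ?thesis
    using edge_unique[of A B i j] assms by auto
qed

lemma card_ge_2:
  assumes "e \<in> [V]\<^bsup>2\<^esup>"
  shows "2 \<le> k"
proof -
  obtain F where F: "F \<in> \<E>" "e \<subseteq> F"
    using assms by (rule ex_edge_superset)
  then have "card e \<le> card F"
    using finite_edge card_mono by blast
  then show ?thesis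
    using card_edge[OF F(1)] assms by (simp add: nsets_def)
qed

lemma edges_cover:
  assumes "2 \<le> card V"
  shows "\<Union>\<E> = V"
proof -
  have "\<exists>w\<in>V. w \<noteq> v" for v
  proof (rule ccontr)
    assume "\<not> (\<exists>w\<in>V. w \<noteq> v)"
    then have "card V \<le> card {v}"
      by (intro card_mono) auto
    then show False
      using assms by simp
  qed
  then show ?thesis
    using ex_edge edge_subset by blast
qed

lemma complete_if_k_2:
  assumes "k = 2"
  shows "\<E> = [V]\<^bsup>2\<^esup>"
proof (intro equalityI subsetI)
  fix A assume "A \<in> \<E>"
  then show "A \<in> [V]\<^bsup>2\<^esup>"
    using assms card_edge edge_subset finite_edge by (auto simp: nsets_def)
next
  fix e assume e: "e \<in> [V]\<^bsup>2\<^esup>"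
  then obtain F where F: "F \<in> \<E>" "e \<subseteq> F"
    by (rule ex_edge_superset)
  then have "e = F"
    using card_subset_eq[OF finite_edge[OF F(1)] F(2)] card_edge[OF F(1)] e assms by (simp add: nsets_def)
  then show "e \<in> \<E>"
    using F by simp
qed

lemma card_edge_Diff:
  assumes "e \<in> [V]\<^bsup>2\<^esup>" "A \<in> \<E>"
  shows "card (A - e) = (if e \<subseteq> A then k - 2 else if A \<inter> e = {} then k else k - 1)"
proof -
  obtain i j where e: "e = {i, j}" "i \<noteq> j"
    using assms(1) by (rule nsets2_E)
  have "A \<inter> e = (if e \<subseteq> A then {i, j} else if A \<inter> e = {} then {} else if i \<in> A then {i} else {j})"
    using e by auto
  then have "card (A \<inter> e) = (if e \<subseteq> A then 2 else if A \<inter> e = {} then 0 else 1)"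
    using e(2) by (auto split: if_splits)
  then show ?thesis
    using card_Diff_subset_Int[of A e] finite_edge[OF assms(2)] card_edge[OF assms(2)] by simp
qed

text \<open>Its purpose is to recognise the image of the edge through \<open>e\<close> by its
  smaller size.\<close>

lemma card_collapse_edge:
  assumes "e \<in> [V]\<^bsup>2\<^esup>" "A \<in> \<E>"
  shows "card (collapse e ` A) = (if e \<subseteq> A then k - 1 else k)"
proof -
  have "card (collapse e ` A) = card (A - e) + (if A \<inter> e = {} then 0 else 1)"
    using finite_edge[OF assms(2)] by (auto simp: collapse_image card_image card_insert_if)
  moreover have "e \<noteq> {}"
    using assms(1) by (auto simp: nsets_def)
  ultimately show ?thesis
    using card_edge_Diff[OF assms] card_ge_2[OF assms(1)] by auto
qed

text \<open>Edges with equal images agree off \<open>e\<close>. Two edges containing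
  \<open>e\<close> coincide anyway; otherwise the common part off \<open>e\<close> has at least
  \<open>k - 1\<close>, hence at least two, vertices and determines the edge. Thus nothing cancels
  in \<open>\<H>\<^sub>e\<close>.\<close>

lemma inj_on_collapse_edges:
  assumes "3 \<le> k" "e \<in> [V]\<^bsup>2\<^esup>"
  shows "inj_on ((`) (collapse e)) \<E>"
proof (rule inj_onI)
  fix A B assume A: "A \<in> \<E>" and B: "B \<in> \<E>" and "collapse e ` A = collapse e ` B"
  then have eq: "A - e = B - e"
    by (auto simp: collapse_image_eq_iff) (auto simp: collapse_def split: if_splits)
  show "A = B"
  proof (cases "e \<subseteq> A \<and> e \<subseteq> B")
    case True
    then show ?thesis
      using edge_superset_unique[OF assms(2) A B] by blast
  next
    case False
    then have "2 \<le> card (A - e)"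
      using card_edge_Diff[OF assms(2) A] card_edge_Diff[OF assms(2) B] eq assms(1)
      by (auto split: if_splits)
    then obtain D where "D \<subseteq> A - e" "card D = 2"
      by (meson obtain_subset_with_card_n)
    then obtain v w where "v \<in> A - e" "w \<in> A - e" "v \<noteq> w"
      by (auto simp: card_2_iff)
    then show ?thesis
      using edge_unique[OF A B, of v w] eq by blast
  qed
qed

lemma identify_eq_image:
  assumes "3 \<le> k" "e \<in> [V]\<^bsup>2\<^esup>"
  shows "identify (V, \<E>) e = (collapse e ` V, (`) (collapse e) ` \<E>)"
  by (simp only: identify_eq[OF edge_subset assms(2)] push_inj[OF inj_on_collapse_edges[OF assms]])

lemma collapse_edges_Pow: "(`) (collapse e) ` \<E> \<subseteq> Pow (collapse e ` V)"
  using edge_subset by (intro image_subsetI PowI image_mono) auto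

section \<open>From the identified hypergraph to the deleted one\<close>

lemma Some_image_in_collapse_iff:
  assumes "D \<inter> e = {}"
  shows "Some ` D \<in> (`) (collapse e) ` \<E> \<longleftrightarrow> D \<in> \<E>"
proof -
  have "Some ` D = collapse e ` A \<longleftrightarrow> A = D" for A
    unfolding eq_commute[of "Some ` D"]
    using assms by (auto simp: collapse_image_eq_iff inj_vimage_image_eq)
  then show ?thesis
    by (simp add: image_iff)
qed

text \<open>If \<open>V\<close> is an edge then \<open>k = card V\<close>, so it is the only edge
  and every deletion is edgeless. In this degenerate case an isomorphism may move the new
  vertex.\<close>

lemma hg_iso_delete_if_single_edge:
  assumes "e \<in> [V]\<^bsup>2\<^esup>" "e' \<in> [V]\<^bsup>2\<^esup>" "V \<in> \<E>"
  shows "hg_iso (delete_vertices (V, \<E>) e) (delete_vertices (V, \<E>) e')"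
proof -
  have "A = V" if "A \<in> \<E>" for A
    using that edge_subset card_edge[OF that] card_edge[OF assms(3)]
    by (intro card_subset_eq[OF finite_V]) auto
  moreover have "V \<inter> d \<noteq> {}" if "d \<in> [V]\<^bsup>2\<^esup>" for d
    using that by (auto elim: nsets2_E)
  ultimately have eq: "delete_vertices (V, \<E>) d = (V - d, {})" if "d \<in> [V]\<^bsup>2\<^esup>" for d
    using that by fastforce
  have "card (V - e) = card (V - e')"
    using assms by (simp add: nsets_def card_Diff_subset)
  then have "\<exists>g. bij_betw g (V - e) (V - e')"
    using finite_same_card_bij finite_V by (metis finite_Diff)
  then show ?thesis
    unfolding eq[OF assms(1)] eq[OF assms(2)] by simp
qed

text \<open>An isomorphism that fixes \<open>None\<close> restricts to the old vertices, and the
  edges avoiding \<open>None\<close> are exactly the edges of the deleted hypergraph.\<close>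

lemma hg_iso_delete_if_identify:
  assumes k: "3 \<le> k" and e: "e \<in> [V]\<^bsup>2\<^esup>" and e': "e' \<in> [V]\<^bsup>2\<^esup>"
    and iso: "hg_iso (identify (V, \<E>) e) (identify (V, \<E>) e')"
  shows "hg_iso (delete_vertices (V, \<E>) e) (delete_vertices (V, \<E>) e')"
proof (cases "V \<in> \<E>")
  case True
  then show ?thesis
    by (rule hg_iso_delete_if_single_edge[OF e e'])
next
  case False
  obtain \<phi> where bij: "bij_betw \<phi> (collapse e ` V) (collapse e' ` V)"
    and iff: "\<And>B. B \<subseteq> collapse e ` V \<Longrightarrow> B \<in> (`) (collapse e) ` \<E> \<longleftrightarrow> \<phi> ` B \<in> (`) (collapse e') ` \<E>"
    using iso unfolding identify_eq_image[OF k e] identify_eq_image[OF k e'] hg_iso.simps by blast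
  note inj = bij_betw_imp_inj_on[OF bij]
  have image_edge: "\<exists>A'\<in>\<E>. \<phi> ` collapse e ` A = collapse e' ` A'" if "A \<in> \<E>" for A
  proof -
    have "collapse e ` A \<subseteq> collapse e ` V"
      using that edge_subset by (intro image_mono) auto
    then have "\<phi> ` collapse e ` A \<in> (`) (collapse e') ` \<E>"
      using imageI[OF that] by (rule iff[THEN iffD1])
    then show ?thesis
      by (simp only: image_iff)
  qed
  \<comment> \<open>\<open>\<H>\<^sub>e\<close> has a single edge of size \<open>k - 1\<close>, and \<open>None\<close> is the only vertex on it that
    lies in two distinct edges with a further common vertex (if \<open>V\<close> is not itself an edge).\<close>
  have \<phi>_None: "\<phi> None = None"
  proof (rule ccontr)
    assume "\<phi> None \<noteq> None"
    then obtain v where v: "\<phi> None = Some v"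
      by blast
    obtain i j where ij: "e = {i, j}" "i \<noteq> j" "i \<in> V" "j \<in> V"
      using e by (rule nsets2_E)
    obtain F where F: "F \<in> \<E>" "e \<subseteq> F"
      using e by (rule ex_edge_superset)
    obtain F' where F': "F' \<in> \<E>" "\<phi> ` collapse e ` F = collapse e' ` F'"
      using image_edge[OF F(1)] by blast
    have "collapse e ` F \<subseteq> collapse e ` V"
      using F(1) edge_subset by blast
    then have "card (collapse e' ` F') = card (collapse e ` F)"
      unfolding F'(2)[symmetric] using inj by (intro card_image) (rule inj_on_subset)
    \<comment> \<open>The isomorphism preserves sizes, and only the image of the edge through
      \<open>e'\<close> has size \<open>k - 1\<close>.\<close>
    then have e'F': "e' \<subseteq> F'"
      using card_collapse_edge[OF e F(1)] card_collapse_edge[OF e' F'(1)] F(2) k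
      by (auto split: if_splits)
    have NoneI: "None \<in> collapse e ` A" if "A \<inter> e \<noteq> {}" for A
      using that by (auto simp: collapse_image)
    have v_mem: "v \<in> A' - e'"
      if "\<phi> ` collapse e ` A = collapse e' ` A'" "A \<inter> e \<noteq> {}" for A A'
    proof -
      have "Some v \<in> collapse e' ` A'"
        unfolding that(1)[symmetric] v[symmetric] using NoneI[OF that(2)] by (rule imageI)
      then show ?thesis
        by (auto simp: collapse_def split: if_splits)
    qed
    have vF': "v \<in> F' - e'"
      using v_mem[OF F'(2)] F(2) ij(1) by blast
    obtain w where w: "w \<in> V" "w \<notin> F"
    proof -
      have "F \<subseteq> V" "F \<noteq> V"
        using False F(1) edge_subset by auto
      then show thesis
        using that by blast
    qed
    have we: "w \<notin> e"
      using w F(2) by blast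
    \<comment> \<open>The edges joining \<open>w\<close> to the two vertices of \<open>e\<close> are
      distinct since \<open>w\<close> is off \<open>F\<close>; their images under
      \<open>collapse e\<close> share both \<open>None\<close> and \<open>w\<close>.\<close>
    obtain A where A: "A \<in> \<E>" "w \<in> A" "i \<in> A"
      using ex_edge[of w i] w(1) we ij by auto
    obtain B where B: "B \<in> \<E>" "w \<in> B" "j \<in> B"
      using ex_edge[of w j] w(1) we ij by auto
    have "A \<noteq> B"
    proof
      assume "A = B"
      then have "A = F"
        using edge_superset_unique[OF e A(1) F(1)] A B F(2) ij(1) by blast
      then show False
        using w A(2) by blast
    qed
    obtain A' where A': "A' \<in> \<E>" "\<phi> ` collapse e ` A = collapse e' ` A'"
      using image_edge[OF A(1)] by blast
    obtain B' where B': "B' \<in> \<E>" "\<phi> ` collapse e ` B = collapse e' ` B'"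
      using image_edge[OF B(1)] by blast
    have "A' \<noteq> B'"
    proof
      assume "A' = B'"
      moreover have "collapse e ` A \<subseteq> collapse e ` V" "collapse e ` B \<subseteq> collapse e ` V"
        using A(1) B(1) edge_subset by blast+
      ultimately have "collapse e ` A = collapse e ` B"
        using inj_on_image_eq_iff[OF inj] A'(2) B'(2) by metis
      then show False
        using inj_onD[OF inj_on_collapse_edges[OF k e]] A(1) B(1) \<open>A \<noteq> B\<close> by blast
    qed
    have vAB: "v \<in> A' - e'" "v \<in> B' - e'"
      using v_mem[OF A'(2)] v_mem[OF B'(2)] A(3) B(3) ij(1) by auto
    have "Some w = collapse e w"
      using we by (simp add: collapse_def)
    then have w_mem: "\<phi> (Some w) \<in> collapse e' ` A'" "\<phi> (Some w) \<in> collapse e' ` B'"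
      unfolding A'(2)[symmetric] B'(2)[symmetric] using A(2) B(2) by auto
    have "None \<in> collapse e ` V" "Some w \<in> collapse e ` V"
      using collapse_vertices[OF e] w(1) we by auto
    then have "\<phi> (Some w) \<noteq> \<phi> None"
      using inj_onD[OF inj] by blast
    show False
    \<comment> \<open>If the image of \<open>w\<close> is \<open>None\<close>, both
      \<open>A'\<close> and \<open>B'\<close> meet \<open>e'\<close> and contain \<open>v\<close>,
      so both equal \<open>F'\<close>. Otherwise they share two distinct old vertices, which also
      forces \<open>A' = B'\<close>.\<close>
    proof (cases "\<phi> (Some w)")
      case None
      have "C = F'" if "C \<in> \<E>" "None \<in> collapse e' ` C" "v \<in> C - e'" for C
      proof -
        have "C \<inter> e' \<noteq> {}"
          using that(2) by (auto simp: collapse_image split: if_splits)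
        then obtain x where "x \<in> C" "x \<in> e'"
          by blast
        then show ?thesis
          using edge_unique[OF that(1) F'(1), of x v] that(3) vF' e'F' by blast
      qed
      then show False
        using A'(1) B'(1) w_mem vAB \<open>A' \<noteq> B'\<close> None by metis
    next
      case (Some u)
      then have "u \<in> A'" "u \<in> B'" "u \<noteq> v"
        using w_mem \<open>\<phi> (Some w) \<noteq> \<phi> None\<close> v by (auto simp: collapse_def split: if_splits)
      then show False
        using edge_unique[OF A'(1) B'(1), of u v] vAB \<open>A' \<noteq> B'\<close> by blast
    qed
  qed
  define \<psi> where "\<psi> = the \<circ> (\<phi> \<circ> Some)"
  have "bij_betw \<phi> (insert None (Some ` (V - e)) - {None}) (insert None (Some ` (V - e')) - {\<phi> None})"
    using bij unfolding collapse_vertices[OF e] collapse_vertices[OF e']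
    by (intro bij_betw_DiffI) (auto simp: \<phi>_None bij_betw_def)
  then have bij': "bij_betw \<phi> (Some ` (V - e)) (Some ` (V - e'))"
    by (simp add: \<phi>_None)
  have Some_\<psi>: "Some (\<psi> v) = \<phi> (Some v)" if "v \<in> V - e" for v
    using bij_betw_apply[OF bij', of "Some v"] that by (auto simp: \<psi>_def)
  have "bij_betw \<psi> (V - e) (V - e')"
    unfolding \<psi>_def
    by (intro bij_betw_trans[OF bij_betw_trans[OF _ bij']]) (auto simp: bij_betw_def inj_on_def image_image)
  moreover have "D \<in> \<E> \<and> D \<inter> e = {} \<longleftrightarrow> \<psi> ` D \<in> \<E> \<and> \<psi> ` D \<inter> e' = {}" if D: "D \<subseteq> V - e" for D
  proof -
    have De: "D \<inter> e = {}" "\<psi> ` D \<inter> e' = {}"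
      using D bij_betw_imp_surj_on[OF \<open>bij_betw \<psi> (V - e) (V - e')\<close>] by blast+
    have "\<phi> ` Some ` D = Some ` \<psi> ` D"
      unfolding image_image using D Some_\<psi> by (intro image_cong) auto
    moreover have "Some ` D \<subseteq> collapse e ` V"
      using D collapse_vertices[OF e] by auto
    ultimately show ?thesis
      using iff[of "Some ` D"] De by (simp add: Some_image_in_collapse_iff)
  qed
  ultimately show ?thesis
    unfolding delete_vertices.simps hg_iso.simps mem_Collect_eq by blast
qed

section \<open>From the deleted hypergraph back to the identified one\<close>

lemma lines_delete:
  assumes k: "3 \<le> k" and e: "e \<in> [V]\<^bsup>2\<^esup>"
  shows "lines k (V - e) {A \<in> \<E>. A \<inter> e = {}} = (\<lambda>A. A - e) ` {A \<in> \<E>. A \<inter> e \<noteq> {} \<and> \<not> e \<subseteq> A}"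
    (is "?L = ?R")
proof (intro equalityI subsetI)
  fix D assume "D \<in> ?R"
  then obtain A where A: "D = A - e" "A \<in> \<E>" "A \<inter> e \<noteq> {}" "\<not> e \<subseteq> A"
    by blast
  \<comment> \<open>The only edge through two vertices of the trace is \<open>A\<close>, which meets
    \<open>e\<close>.\<close>
  have "v = w" if "B \<in> \<E>" "B \<inter> e = {}" "v \<in> D" "w \<in> D" "v \<in> B" "w \<in> B" for B v w
    using edge_unique[OF A(2) that(1), of v w] that A by auto
  moreover have "card D = k - 1"
    using card_edge_Diff[OF e A(2)] A by simp
  ultimately show "D \<in> ?L"
    using A(1,2) edge_subset by (auto simp: lines_def)
next
  fix D assume D: "D \<in> ?L"
  obtain i j where ij: "e = {i, j}" "i \<noteq> j" "i \<in> V" "j \<in> V"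
    using e by (rule nsets2_E)
  obtain F where F: "F \<in> \<E>" "e \<subseteq> F"
    using e by (rule ex_edge_superset)
  have D_sub: "D \<subseteq> V - e" and D_card: "card D = k - 1"
    using D by (auto simp: lines_def)
  have meets: "B \<inter> e \<noteq> {}" if "B \<in> \<E>" "v \<in> D" "w \<in> D" "v \<noteq> w" "v \<in> B" "w \<in> B" for B v w
    using D that by (auto simp: lines_def)
  \<comment> \<open>The set \<open>F - e\<close> has only \<open>k - 2\<close> elements. A vertex
    \<open>v\<close> of \<open>D\<close> off \<open>F\<close> ensures that the edge through
    \<open>v\<close> and \<open>w\<close> does not contain \<open>e\<close>.\<close>
  have "\<not> D \<subseteq> F - e"
  proof
    assume "D \<subseteq> F - e"
    then have "card D \<le> card (F - e)"
      using finite_edge[OF F(1)] by (intro card_mono) auto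
    then show False
      using card_edge_Diff[OF e F(1)] F(2) D_card k by simp
  qed
  then obtain v where v: "v \<in> D" "v \<notin> F"
    using D_sub by blast
  have "\<not> D \<subseteq> {v}"
  proof
    assume "D \<subseteq> {v}"
    then have "card D \<le> card {v}"
      by (intro card_mono) auto
    then show False
      using D_card k by simp
  qed
  then obtain w where w: "w \<in> D" "w \<noteq> v"
    by blast
  obtain B where B: "B \<in> \<E>" "v \<in> B" "w \<in> B"
    using ex_edge[of v w] v w D_sub by blast
  have Be: "B \<inter> e \<noteq> {}" "\<not> e \<subseteq> B"
    using meets[OF B(1) v(1) w(1)] B w(2) v(2) edge_superset_unique[OF e B(1) F(1)] F(2) by blast+
  \<comment> \<open>Otherwise the edges through \<open>vw\<close>, \<open>uv\<close> and \<open>uw\<close> are distinct and all meet \<open>e\<close>, so two of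
    them share a vertex of \<open>e\<close> besides one of \<open>u\<close>, \<open>v\<close>, \<open>w\<close>.\<close>
  have "u \<in> B" if u: "u \<in> D" for u
  proof (rule ccontr)
    assume uB: "u \<notin> B"
    then have uvw: "u \<noteq> v" "u \<noteq> w"
      using B by auto
    obtain C where C: "C \<in> \<E>" "u \<in> C" "v \<in> C"
      using ex_edge[of u v] u v uvw D_sub by blast
    obtain G where G: "G \<in> \<E>" "u \<in> G" "w \<in> G"
      using ex_edge[of u w] u w uvw D_sub by blast
    have "C \<inter> e \<noteq> {}" "G \<inter> e \<noteq> {}"
      using meets[OF C(1) u v(1)] meets[OF G(1) u w(1)] C G uvw by blast+
    then consider x where "x \<in> e" "x \<in> B" "x \<in> C" | x where "x \<in> e" "x \<in> B" "x \<in> G"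
      | x where "x \<in> e" "x \<in> C" "x \<in> G"
      using Be(1) ij(1) by auto
    then show False
    proof cases
      case 1
      then have "B = C"
        using edge_unique[OF B(1) C(1), of x v] B C v D_sub by blast
      then show False
        using uB C by blast
    next
      case 2
      then have "B = G"
        using edge_unique[OF B(1) G(1), of x w] B G w D_sub by blast
      then show False
        using uB G by blast
    next
      case 3
      then have "C = G"
        using edge_unique[OF C(1) G(1), of x u] C G u D_sub by blast
      then have "C = B"
        using edge_unique[OF C(1) B(1), of v w] B C G w(2) by blast
      then show False
        using uB C by blast
    qed
  qed
  then have "D \<subseteq> B - e"
    using D_sub by blast
  then have "D = B - e"
    using finite_edge[OF B(1)] card_edge_Diff[OF e B(1)] Be D_card by (intro card_subset_eq) auto
  then show "D \<in> ?R"
    using B(1) Be by blast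
qed

text \<open>The edges split into those missing \<open>e\<close>, those meeting it once, and
  \<open>F\<close>. The first survive deletion, the second are recovered by
  \<open>lines_delete\<close>, and \<open>F - e\<close> is what their traces leave
  uncovered.\<close>

lemma collapse_edges_eq_rebuild:
  assumes k: "3 \<le> k" and e: "e \<in> [V]\<^bsup>2\<^esup>"
  shows "(`) (collapse e) ` \<E> = rebuild k (V - e) {A \<in> \<E>. A \<inter> e = {}}"
proof -
  let ?\<G> = "{A \<in> \<E>. A \<inter> e = {}}"
  let ?\<L> = "{A \<in> \<E>. A \<inter> e \<noteq> {} \<and> \<not> e \<subseteq> A}"
  obtain i j where ij: "e = {i, j}" "i \<noteq> j" "i \<in> V" "j \<in> V"
    using e by (rule nsets2_E)
  obtain F where F: "F \<in> \<E>" "e \<subseteq> F"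
    using e by (rule ex_edge_superset)
  \<comment> \<open>For a vertex on no trace, its edge through \<open>i\<close> must contain all of
    \<open>e\<close>. Conversely an edge through a vertex of \<open>F - e\<close> and a vertex of
    \<open>e\<close> is \<open>F\<close>.\<close>
  have "V - e - \<Union>((\<lambda>A. A - e) ` ?\<L>) = F - e"
  proof (intro equalityI subsetI)
    fix v assume v: "v \<in> V - e - \<Union>((\<lambda>A. A - e) ` ?\<L>)"
    then have "v \<noteq> i"
      using ij(1) by auto
    then obtain A where A: "A \<in> \<E>" "v \<in> A" "i \<in> A"
      using ex_edge[of v i] v ij by auto
    then have "e \<subseteq> A"
      using v ij(1) by blast
    then have "A = F"
      using edge_superset_unique[OF e A(1) F(1)] F(2) by blast
    then show "v \<in> F - e"
      using A v by blast
  next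
    fix v assume v: "v \<in> F - e"
    have False if A: "A \<in> \<E>" "A \<inter> e \<noteq> {}" "\<not> e \<subseteq> A" "v \<in> A" for A
    proof -
      obtain x where "x \<in> A" "x \<in> e"
        using A(2) by blast
      then have "A = F"
        using edge_unique[OF A(1) F(1), of x v] A(4) v F(2) by blast
      then show False
        using A(3) F(2) by blast
    qed
    then show "v \<in> V - e - \<Union>((\<lambda>A. A - e) ` ?\<L>)"
      using v F(1) edge_subset by blast
  qed
  then have "rebuild k (V - e) ?\<G> = (`) Some ` ?\<G> \<union>
      (\<lambda>D. insert None (Some ` D)) ` insert (F - e) ((\<lambda>A. A - e) ` ?\<L>)"
    by (simp only: rebuild_def lines_delete[OF k e])
  also have "\<dots> = (`) (collapse e) ` ?\<G> \<union> (`) (collapse e) ` insert F ?\<L>"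
  proof (rule arg_cong2[where f = "(\<union>)"])
    show "(`) Some ` ?\<G> = (`) (collapse e) ` ?\<G>"
      by (rule image_cong[OF refl]) (simp add: collapse_image Diff_triv)
    have "F \<inter> e \<noteq> {}"
      using F(2) ij(1) by blast
    then show "(\<lambda>D. insert None (Some ` D)) ` insert (F - e) ((\<lambda>A. A - e) ` ?\<L>)
        = (`) (collapse e) ` insert F ?\<L>"
      unfolding image_insert image_image
      by (intro arg_cong2[where f = insert] image_cong refl) (simp_all add: collapse_image)
  qed
  also have "\<dots> = (`) (collapse e) ` (?\<G> \<union> insert F ?\<L>)"
    by (rule image_Un[symmetric])
  also have "?\<G> \<union> insert F ?\<L> = \<E>"
    using edge_superset_unique[OF e _ F(1) _ F(2)] F(1) by blast
  finally show ?thesis ..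
qed

lemma hg_iso_identify_if_delete:
  assumes k: "3 \<le> k" and e: "e \<in> [V]\<^bsup>2\<^esup>" and e': "e' \<in> [V]\<^bsup>2\<^esup>"
    and iso: "hg_iso (delete_vertices (V, \<E>) e) (delete_vertices (V, \<E>) e')"
  shows "hg_iso (identify (V, \<E>) e) (identify (V, \<E>) e')"
proof -
  let ?\<G> = "\<lambda>e. {A \<in> \<E>. A \<inter> e = {}}"
  have G: "?\<G> d \<subseteq> Pow (V - d)" for d
    using edge_subset by blast
  obtain \<phi> where \<phi>: "bij_betw \<phi> (V - e) (V - e')" "(`) \<phi> ` ?\<G> e = ?\<G> e'"
    using iso hg_iso_iff[OF G G, of e e'] by auto
  have im: "\<phi> ` (V - e) = V - e'" and inj: "inj_on \<phi> (V - e)"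
    using \<phi>(1) by (auto simp: bij_betw_def)
  have "bij_betw (map_option \<phi>) (collapse e ` V) (collapse e' ` V)"
    using inj unfolding collapse_vertices[OF e] collapse_vertices[OF e'] bij_betw_def im[symmetric]
    by (auto simp: inj_on_def image_image)
  moreover have "(`) (map_option \<phi>) ` (`) (collapse e) ` \<E> = (`) (collapse e') ` \<E>"
    unfolding collapse_edges_eq_rebuild[OF k e] collapse_edges_eq_rebuild[OF k e']
      rebuild_image[OF inj G, symmetric] im \<phi>(2) ..
  ultimately show ?thesis
    unfolding identify_eq_image[OF k e] identify_eq_image[OF k e']
      hg_iso_iff[OF collapse_edges_Pow collapse_edges_Pow] by blast
qed

end

section \<open>Combining the cases into the equivalences\<close>

lemma steiner_systemE:
  assumes "steiner_system (V, \<E>)"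
  obtains k where "steiner V \<E> k"
proof -
  obtain k where V: "finite V" "\<E> \<subseteq> Pow V" and k: "\<E> \<subseteq> [V]\<^bsup>k\<^esup>"
    and ex1: "\<And>e. e \<in> [V]\<^bsup>2\<^esup> \<Longrightarrow> \<exists>!E. E \<in> \<E> \<and> e \<subseteq> E"
    using assms by auto
  have pair: "{v, w} \<in> [V]\<^bsup>2\<^esup>" if "v \<in> V" "w \<in> V" "v \<noteq> w" for v w
    using that by (simp add: nsets_def)
  have "steiner V \<E> k"
  proof
    show "card A = k" if "A \<in> \<E>" for A
      using k that by (auto simp: nsets_def)
    show "\<exists>A\<in>\<E>. v \<in> A \<and> w \<in> A" if "v \<in> V" "w \<in> V" "v \<noteq> w" for v w
    proof -
      have "\<exists>A. A \<in> \<E> \<and> {v, w} \<subseteq> A"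
        using ex1[OF pair[OF that]] by (rule ex1_implies_ex)
      then show ?thesis
        by auto
    qed
    show "A = B" if "A \<in> \<E>" "B \<in> \<E>" "v \<noteq> w" "v \<in> A" "w \<in> A" "v \<in> B" "w \<in> B" for A B v w
    proof -
      have "v \<in> V" "w \<in> V"
        using that V(2) by auto
      from ex1[OF pair[OF this that(3)]] show ?thesis
        using that by (elim ex1E) (metis empty_subsetI insert_subset)
    qed
  qed (fact V)+
  then show thesis
    by (rule that)
qed

context steiner
begin

lemma hg_iso_identify_iff_delete:
  assumes "e \<in> [V]\<^bsup>2\<^esup>" "e' \<in> [V]\<^bsup>2\<^esup>"
  shows "hg_iso (identify (V, \<E>) e) (identify (V, \<E>) e') \<longleftrightarrow>
    hg_iso (delete_vertices (V, \<E>) e) (delete_vertices (V, \<E>) e')"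
proof (cases "3 \<le> k")
  case True
  then show ?thesis
    using hg_iso_delete_if_identify hg_iso_identify_if_delete assms by blast
next
  case False
  then have "\<E> = [V]\<^bsup>2\<^esup>"
    using card_ge_2[OF assms(1)] by (intro complete_if_k_2) simp
  then show ?thesis
    using hg_iso_identify_complete[OF finite_V assms] hg_iso_delete_complete[OF finite_V assms]
    by (simp only:)
qed

text \<open>For \<open>k \<ge> 3\<close> the minors of \<open>\<H>\<^sub>e\<close> for
  \<open>e = e\<^sub>0\<close> provided by irreducibility are isomorphic copies, and any two pairs
  are compared through \<open>e\<^sub>0\<close>. For \<open>k = 2\<close> the right-hand side always
  holds.\<close>

lemma irreducible_iff_identify:
  assumes V: "2 \<le> card V" and \<iota>: "bij_betw \<iota> V {1..card V}"
  shows "irreducible_boolfun (hg_boolfun \<iota> (V, \<E>)) \<longleftrightarrow>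
    (\<forall>e \<in> [V]\<^bsup>2\<^esup>. \<forall>e' \<in> [V]\<^bsup>2\<^esup>. hg_iso (identify (V, \<E>) e) (identify (V, \<E>) e'))"
    (is "?L \<longleftrightarrow> ?R")
proof -
  have "\<exists>\<kappa>. bij_betw \<kappa> (collapse e ` V) {1..card (collapse e ` V)}" for e
    using ex_bij_betw_atLeast_1 finite_V by blast
  then obtain \<kappa> where \<kappa>: "\<And>e. bij_betw (\<kappa> e) (collapse e ` V) {1..card (collapse e ` V)}"
    by metis
  note fin = finite_imageI[OF finite_V] and Pow = push_Pow[OF edge_subset]
  note eq = identify_eq[OF edge_subset]
  note irred = irreducible_hg_boolfun_iff[OF finite_V V edge_subset edges_cover[OF V] \<iota> \<kappa>]
  show ?thesis
  proof
    assume R: ?R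
    obtain e\<^sub>0 where e\<^sub>0: "e\<^sub>0 \<in> [V]\<^bsup>2\<^esup>"
    proof -
      obtain e\<^sub>0 where "e\<^sub>0 \<subseteq> V" "card e\<^sub>0 = 2" "finite e\<^sub>0"
        using obtain_subset_with_card_n[OF V] by blast
      then show thesis
        using that by (simp add: nsets_def)
    qed
    have "simple_minor (hg_boolfun (\<kappa> e) (identify (V, \<E>) e))
        (hg_boolfun (\<kappa> e\<^sub>0) (identify (V, \<E>) e\<^sub>0))" if e: "e \<in> [V]\<^bsup>2\<^esup>" for e
      using R[rule_format, OF e\<^sub>0 e] unfolding eq[OF e] eq[OF e\<^sub>0]
      by (rule simple_minor_if_hg_iso[OF fin Pow \<kappa> fin Pow \<kappa>])
    then show ?L
      unfolding irred using e\<^sub>0 by blast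
  next
    assume ?L
    then obtain e\<^sub>0 where e\<^sub>0: "e\<^sub>0 \<in> [V]\<^bsup>2\<^esup>"
      and minor: "\<forall>e \<in> [V]\<^bsup>2\<^esup>. simple_minor (hg_boolfun (\<kappa> e) (identify (V, \<E>) e))
        (hg_boolfun (\<kappa> e\<^sub>0) (identify (V, \<E>) e\<^sub>0))"
      unfolding irred by (elim bexE)
    show ?R
    proof (cases "3 \<le> k")
      case True
      have iso: "hg_iso (identify (V, \<E>) e\<^sub>0) (identify (V, \<E>) e)" if e: "e \<in> [V]\<^bsup>2\<^esup>" for e
      proof -
        \<comment> \<open>As no edges cancel, every vertex of the quotient remains on an
          edge.\<close>
        have "\<Union>(push (collapse e) \<E>) = collapse e ` \<Union>\<E>"
          unfolding push_inj[OF inj_on_collapse_edges[OF True e]] by blast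
        then have "\<Union>(push (collapse e) \<E>) = collapse e ` V"
          by (simp only: edges_cover[OF V])
        moreover have "card (collapse e\<^sub>0 ` V) = card (collapse e ` V)"
          using card_collapse[OF finite_V] e e\<^sub>0 by simp
        ultimately show ?thesis
          using minor[rule_format, OF e] unfolding eq[OF e] eq[OF e\<^sub>0]
          by (intro hg_iso_if_simple_minor[OF fin Pow \<kappa> fin Pow \<kappa>])
      qed
      show ?thesis
      proof (intro ballI)
        fix e e' assume e: "e \<in> [V]\<^bsup>2\<^esup>" and e': "e' \<in> [V]\<^bsup>2\<^esup>"
        have "hg_iso (identify (V, \<E>) e) (identify (V, \<E>) e\<^sub>0)"
          using iso[OF e] unfolding eq[OF e] eq[OF e\<^sub>0] by (rule hg_iso_sym[OF _ Pow Pow])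
        then show "hg_iso (identify (V, \<E>) e) (identify (V, \<E>) e')"
          using iso[OF e'] unfolding eq[OF e] eq[OF e\<^sub>0] eq[OF e']
          by (rule hg_iso_trans[OF _ _ Pow Pow Pow])
      qed
    next
      case False
      then have "\<E> = [V]\<^bsup>2\<^esup>"
        using card_ge_2[OF e\<^sub>0] by (intro complete_if_k_2) simp
      then show ?thesis
        using hg_iso_identify_complete[OF finite_V] by (simp only:) blast
    qed
  qed
qed

end

text \<open>The bound on \<open>card V\<close> excludes a single vertex: there the conditions on
  pairs hold vacuously, whereas a function of one variable has no strict minors and so is not
  irreducible.\<close>

theorem theorem14:
  fixes V :: "'a set" and \<E> :: "'a set set" and \<iota> :: "'a \<Rightarrow> nat"
  assumes "steiner_system (V, \<E>)"
    and "2 \<le> card V"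
    and "bij_betw \<iota> V {1..card V}"
  shows "(irreducible_boolfun (hg_boolfun \<iota> (V, \<E>)) \<longleftrightarrow>
            (\<forall>e \<in> [V]\<^bsup>2\<^esup>. \<forall>e' \<in> [V]\<^bsup>2\<^esup>. hg_iso (identify (V, \<E>) e) (identify (V, \<E>) e')))
       \<and> ((\<forall>e \<in> [V]\<^bsup>2\<^esup>. \<forall>e' \<in> [V]\<^bsup>2\<^esup>. hg_iso (identify (V, \<E>) e) (identify (V, \<E>) e')) \<longleftrightarrow>
            minus2_monomorphic (V, \<E>))"
proof -
  obtain k where "steiner V \<E> k"
    using assms(1) by (rule steiner_systemE)
  then interpret steiner V \<E> k .
  show ?thesis
    unfolding minus2_monomorphic.simps
    by (intro conjI irreducible_iff_identify[OF assms(2,3)] ball_cong refl hg_iso_identify_iff_delete)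
qed

end
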